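(* Let $(G,\partial G,E)$ be a finite graph with boundary. Suppose there exists a function $h:G\cup\partial G\to\mathbb R$ satisfying: (1) if $x\sim y$ then $|h(x)-h(y)|\le 1$; (2) $|N_{+}(x)|=|N_-(x)|=1$ for all $x\in G$, and $|N_{+}(z)|\le1$, $|N_-(z)|\le 1$ for all $z\in\partial G$, where $N_{+}(x)=\{y\in G\cup\partial G: y\sim x,\ h(y)=h(x)+1\}$ and $N_{-}(x)=\{y\in G\cup\partial G: y\sim x,\ h(y)=h(x)-1\}$. Then $(G,\partial G,E)$ satisfies the Two-Points Condition: every subset $S\subseteq G$ with $|S|\ge2$ has at least two extreme points with respect to $\partial G$.
   Context: A graph with boundary $(G,\partial G,E)$ consists of disjoint sets $G$ (interior vertices) and $\partial G$ (boundary vertices) and a set $E$ of two-element subsets of $G\cup\partial G$ (undirected simple graph); it is finite if $G\cup\partial G$ is finite. $x\sim y$ means $\{x,y\}\in E$. $d(x,y)$ is the minimal number of edges in a path from $x$ to $y$ in $(G\cup\partial G,E)$ ($\infty$ if there is no path). For $S\subseteq G$, a point $x_0\in S$ is an extreme point of $S$ with respect to $\partial G$ if there is $z\in\partial G$ such that $x_0$ is the unique nearest point in $S$ from $z$ with respect to $d$. *)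

theory Defs
  imports Complex_Main "HOL-Library.Extended_Nat"
begin

definition graph_with_boundary :: "'a set \<Rightarrow> 'a set \<Rightarrow> 'a set set \<Rightarrow> bool" where
  "graph_with_boundary G B E \<longleftrightarrow>
     G \<inter> B = {} \<and> (\<forall>e\<in>E. e \<subseteq> G \<union> B \<and> card e = 2)"

definition finite_graph_with_boundary :: "'a set \<Rightarrow> 'a set \<Rightarrow> 'a set set \<Rightarrow> bool" where
  "finite_graph_with_boundary G B E \<longleftrightarrow> graph_with_boundary G B E \<and> finite (G \<union> B)"

definition adj :: "'a set set \<Rightarrow> 'a \<Rightarrow> 'a \<Rightarrow> bool" where
  "adj E x y \<longleftrightarrow> {x, y} \<in> E"

(* A path is given by its list of vertices, so it has length p - 1 edges. Vertices may repeat;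
   this does not affect the minimal number of edges. *)
definition path_between :: "'a set \<Rightarrow> 'a set \<Rightarrow> 'a set set \<Rightarrow> 'a \<Rightarrow> 'a list \<Rightarrow> 'a \<Rightarrow> bool" where
  "path_between G B E x p y \<longleftrightarrow>
     p \<noteq> [] \<and> set p \<subseteq> G \<union> B \<and> hd p = x \<and> last p = y \<and> successively (adj E) p"

(* The infimum of the empty set in enat is \<infinity>. *)
definition graph_dist :: "'a set \<Rightarrow> 'a set \<Rightarrow> 'a set set \<Rightarrow> 'a \<Rightarrow> 'a \<Rightarrow> enat" where
  "graph_dist G B E x y = (INF p\<in>{p. path_between G B E x p y}. enat (length p - 1))"

definition nearest_points ::
    "'a set \<Rightarrow> 'a set \<Rightarrow> 'a set set \<Rightarrow> 'a set \<Rightarrow> 'a \<Rightarrow> 'a set" where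
  "nearest_points G B E S z =
     {x \<in> S. \<forall>y\<in>S. graph_dist G B E x z \<le> graph_dist G B E y z}"

definition extreme_point ::
    "'a set \<Rightarrow> 'a set \<Rightarrow> 'a set set \<Rightarrow> 'a set \<Rightarrow> 'a \<Rightarrow> bool" where
  "extreme_point G B E S x0 \<longleftrightarrow> x0 \<in> S \<and> (\<exists>z\<in>B. nearest_points G B E S z = {x0})"

(* Intended for finite graphs with boundary, where card is the true cardinality. *)
definition two_points_condition :: "'a set \<Rightarrow> 'a set \<Rightarrow> 'a set set \<Rightarrow> bool" where
  "two_points_condition G B E \<longleftrightarrow>
     (\<forall>S. S \<subseteq> G \<and> card S \<ge> 2 \<longrightarrow> card {x. extreme_point G B E S x} \<ge> 2)"

definition N_plus ::
    "'a set \<Rightarrow> 'a set \<Rightarrow> 'a set set \<Rightarrow> ('a \<Rightarrow> real) \<Rightarrow> 'a \<Rightarrow> 'a set" where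
  "N_plus G B E h x = {y \<in> G \<union> B. adj E y x \<and> h y = h x + 1}"

definition N_minus ::
    "'a set \<Rightarrow> 'a set \<Rightarrow> 'a set set \<Rightarrow> ('a \<Rightarrow> real) \<Rightarrow> 'a \<Rightarrow> 'a set" where
  "N_minus G B E h x = {y \<in> G \<union> B. adj E y x \<and> h y = h x - 1}"

end

theory Submission
  imports Defs
begin

text \<open>
  Read \<open>h\<close> as a height. Call a step along an edge an ascent if it raises the height by exactly 1.
  From an interior vertex one can always ascend, because \<open>N_plus\<close> is a singleton there, and no vertex
  can be entered by two different ascents, because \<open>N_minus\<close> has at most one element everywhere. As
  the graph is finite, repeated ascents from an interior vertex \<open>x\<close> lead to a boundary vertex \<open>z\<close>,
  say in \<open>n\<close> steps (lemma \<open>ascends_to_boundary\<close>), so \<open>x\<close> is within distance \<open>n\<close> of \<open>z\<close>.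

  Since \<open>h\<close> changes by at most 1 along an edge, a path with \<open>m\<close> edges raises the height by at most
  \<open>m\<close>, with equality only if each of its steps is an ascent (lemma \<open>path_height\<close>). Now let \<open>x\<close> be a
  highest point of \<open>S\<close>. A point of \<open>S\<close> within distance \<open>n\<close> of \<open>z\<close> has to climb at least the \<open>n\<close>
  levels that \<open>x\<close> climbs, so it reaches \<open>z\<close> by exactly \<open>n\<close> ascents, and then it is \<open>x\<close>, because
  ascents can be traced back uniquely. So \<open>x\<close> is the unique point of \<open>S\<close> nearest to \<open>z\<close>, and every
  highest point of \<open>S\<close> is extreme (lemma \<open>highest_point_extreme\<close>). Replacing \<open>h\<close> by \<open>-h\<close>, every
  lowest point is extreme as well. If \<open>h\<close> is not constant on \<open>S\<close>, a highest and a lowest point are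
  two extreme points; if \<open>h\<close> is constant on \<open>S\<close>, all points of \<open>S\<close> are extreme.
\<close>

definition ascents ::
    "'a set \<Rightarrow> 'a set \<Rightarrow> 'a set set \<Rightarrow> ('a \<Rightarrow> real) \<Rightarrow> ('a \<times> 'a) set" where
  "ascents G B E h = {(x, y). x \<in> G \<union> B \<and> y \<in> N_plus G B E h x}"

lemma adj_commute: "adj E x y \<longleftrightarrow> adj E y x"
  by (simp add: adj_def insert_commute)

lemma path_between_Cons:
  "path_between G B E x (a # p) y \<longleftrightarrow>
     a = x \<and> x \<in> G \<union> B \<and>
     (p = [] \<and> x = y \<or> (\<exists>w. adj E x w \<and> path_between G B E w p y))"
  by (cases p) (auto simp: path_between_def)

text \<open>Bounding by a finite \<open>n\<close> hides the infimum: a distance at most \<open>n\<close> is always witnessed by a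
  path, whereas the value \<open>\<infinity>\<close> has no path behind it.\<close>

lemma graph_dist_le_iff:
  "graph_dist G B E x y \<le> enat n \<longleftrightarrow> (\<exists>p. path_between G B E x p y \<and> length p - 1 \<le> n)"
proof -
  have "graph_dist G B E x y \<le> enat n \<longleftrightarrow> graph_dist G B E x y < enat (Suc n)"
    by (cases "graph_dist G B E x y") auto
  also have "\<dots> \<longleftrightarrow> (\<exists>p. path_between G B E x p y \<and> length p - 1 < Suc n)"
    by (auto simp: graph_dist_def INF_less_iff)
  finally show ?thesis by (simp add: less_Suc_eq_le)
qed

lemma path_of_ascents:
  assumes "x \<in> G \<union> B" "(x, z) \<in> ascents G B E h ^^ n"
  shows "(\<exists>p. path_between G B E x p z \<and> length p = Suc n) \<and> h z = h x + n"
  using assms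
proof (induction n arbitrary: x)
  case 0
  then have "path_between G B E x [x] z" by (simp add: path_between_def)
  with 0 show ?case by fastforce
next
  case (Suc n)
  from Suc.prems(2) obtain w where w: "(x, w) \<in> ascents G B E h" "(w, z) \<in> ascents G B E h ^^ n"
    by (rule relpow_Suc_E2)
  then have "w \<in> G \<union> B" "adj E x w" "h w = h x + 1"
    by (auto simp: ascents_def N_plus_def adj_commute)
  moreover obtain p where "path_between G B E w p z" "length p = Suc n"
    using Suc.IH \<open>w \<in> G \<union> B\<close> w(2) by blast
  ultimately have "path_between G B E x (x # p) z" "length (x # p) = Suc (Suc n)"
    using Suc.prems(1) by (auto simp: path_between_Cons)
  moreover have "h z = h x + Suc n"
    using Suc.IH[OF \<open>w \<in> G \<union> B\<close> w(2)] \<open>h w = h x + 1\<close> by simp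
  ultimately show ?case by blast
qed

text \<open>The rigidity statement behind the theorem: since each step raises the height by at most 1,
  a path that gains its full length in height cannot waste a single step.\<close>

lemma path_height:
  assumes lip: "\<forall>x\<in>G \<union> B. \<forall>y\<in>G \<union> B. adj E x y \<longrightarrow> \<bar>h x - h y\<bar> \<le> (1::real)"
    and "path_between G B E x p z" "length p = Suc n"
  shows "h z \<le> h x + n \<and> (h z = h x + n \<longrightarrow> (x, z) \<in> ascents G B E h ^^ n)"
  using assms(2,3)
proof (induction n arbitrary: x p)
  case 0
  then show ?case by (auto simp: length_Suc_conv path_between_Cons path_between_def)
next
  case (Suc n)
  from Suc.prems(2) obtain a q where "p = a # q" "length q = Suc n"
    by (auto simp: length_Suc_conv)
  with Suc.prems(1) obtain w where x: "x \<in> G \<union> B" and w: "adj E x w" "path_between G B E w q z"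
    by (auto simp: path_between_Cons)
  have "w \<in> G \<union> B" using w(2) hd_in_set[of q] by (auto simp: path_between_def)
  then have step: "h w \<le> h x + 1" using lip x w(1) by force
  have IH: "h z \<le> h w + n" "h z = h w + n \<longrightarrow> (w, z) \<in> ascents G B E h ^^ n"
    using Suc.IH[OF w(2) \<open>length q = Suc n\<close>] by auto
  show ?case
  proof (intro conjI impI)
    show "h z \<le> h x + Suc n" using step IH(1) by simp
  next
    assume "h z = h x + Suc n"
    then have eq: "h w = h x + 1" "h z = h w + n" using step IH(1) by auto
    have "(x, w) \<in> ascents G B E h"
      using x w(1) \<open>w \<in> G \<union> B\<close> eq(1) by (auto simp: ascents_def N_plus_def adj_commute)
    then show "(x, z) \<in> ascents G B E h ^^ Suc n"
      using IH(2) eq(2) by (blast intro: relpow_Suc_I2)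
  qed
qed

lemma ascents_left_unique:
  assumes "finite (G \<union> B)" "\<forall>z\<in>G \<union> B. card (N_minus G B E h z) \<le> 1"
    and "(x, z) \<in> ascents G B E h" "(y, z) \<in> ascents G B E h"
  shows "x = y"
proof -
  have "finite (N_minus G B E h z)"
    by (rule finite_subset[OF _ assms(1)]) (auto simp: N_minus_def)
  moreover have "card (N_minus G B E h z) \<le> 1"
    using assms(2,3) by (auto simp: ascents_def N_plus_def)
  moreover have "x \<in> N_minus G B E h z" "y \<in> N_minus G B E h z"
    using assms(3,4) by (auto simp: ascents_def N_plus_def N_minus_def adj_commute)
  ultimately show ?thesis by (auto simp: card_le_Suc0_iff_eq)
qed

lemma iterated_ascents_left_unique:
  assumes "finite (G \<union> B)" "\<forall>z\<in>G \<union> B. card (N_minus G B E h z) \<le> 1"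
    and "(x, z) \<in> ascents G B E h ^^ n" "(y, z) \<in> ascents G B E h ^^ n"
  shows "x = y"
  using assms(3,4)
proof (induction n arbitrary: z)
  case (Suc n)
  then obtain v w where "(x, v) \<in> ascents G B E h ^^ n" "(v, z) \<in> ascents G B E h"
    "(y, w) \<in> ascents G B E h ^^ n" "(w, z) \<in> ascents G B E h"
    by auto
  moreover from this have "v = w" using ascents_left_unique[OF assms(1,2)] by blast
  ultimately show ?case using Suc.IH[of v] by simp
qed simp

text \<open>Heights strictly increase along ascents, so the number of vertices above the current one
  decreases and the boundary must be met.\<close>

lemma ascends_to_boundary:
  assumes fin: "finite (G \<union> B)" and up: "\<forall>x\<in>G. N_plus G B E h x \<noteq> {}"
    and "x \<in> G"
  shows "\<exists>z\<in>B. \<exists>n. (x, z) \<in> ascents G B E h ^^ n"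
  using \<open>x \<in> G\<close>
proof (induction "card {y \<in> G \<union> B. h x < h y}" arbitrary: x rule: less_induct)
  case less
  obtain w where w: "w \<in> N_plus G B E h x" using up less.prems by blast
  then have asc: "(x, w) \<in> ascents G B E h" and hw: "w \<in> G \<union> B" "h w = h x + 1"
    using less.prems by (auto simp: ascents_def N_plus_def)
  show ?case
  proof (cases "w \<in> B")
    case True
    with asc show ?thesis by (metis relpow_1)
  next
    case False
    have "{y \<in> G \<union> B. h w < h y} \<subseteq> {y \<in> G \<union> B. h x < h y}"
      using hw(2) by auto
    moreover have "w \<in> {y \<in> G \<union> B. h x < h y} - {y \<in> G \<union> B. h w < h y}"
      using hw by simp
    ultimately have "{y \<in> G \<union> B. h w < h y} \<subset> {y \<in> G \<union> B. h x < h y}"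
      by blast
    then have "card {y \<in> G \<union> B. h w < h y} < card {y \<in> G \<union> B. h x < h y}"
      using fin by (intro psubset_card_mono) auto
    then obtain z n where "z \<in> B" "(w, z) \<in> ascents G B E h ^^ n"
      using less.hyps False hw(1) by blast
    with asc show ?thesis by (blast intro: relpow_Suc_I2)
  qed
qed

text \<open>The witness is the boundary vertex \<open>z\<close> found by ascending \<open>n\<close> times from \<open>x\<close>. The fact \<open>far\<close>
  combines the two constraints on a competitor \<open>y\<close> within distance \<open>n\<close> of \<open>z\<close>: it starts no
  higher than \<open>x\<close> and has no more steps available, so both bounds are attained.\<close>

lemma highest_point_extreme:
  assumes fin: "finite (G \<union> B)"
    and lip: "\<forall>x\<in>G \<union> B. \<forall>y\<in>G \<union> B. adj E x y \<longrightarrow> \<bar>h x - h y\<bar> \<le> (1::real)"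
    and up: "\<forall>x\<in>G. N_plus G B E h x \<noteq> {}"
    and down: "\<forall>z\<in>G \<union> B. card (N_minus G B E h z) \<le> 1"
    and x: "x \<in> S" "S \<subseteq> G" "\<forall>y\<in>S. h y \<le> h x"
  shows "extreme_point G B E S x"
proof -
  have "x \<in> G" using x by blast
  then obtain z n where z: "z \<in> B" "(x, z) \<in> ascents G B E h ^^ n"
    using ascends_to_boundary[OF fin up] by blast
  then obtain p where p: "path_between G B E x p z" "length p = Suc n" and hz: "h z = h x + n"
    using path_of_ascents[OF UnI1[OF \<open>x \<in> G\<close>]] by blast
  have near: "graph_dist G B E x z \<le> enat n"
    using p by (auto simp: graph_dist_le_iff)
  have far: "y = x" if "y \<in> S" "graph_dist G B E y z \<le> enat n" for y
  proof -
    from that(2) obtain q where q: "path_between G B E y q z" "length q - 1 \<le> n"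
      by (auto simp: graph_dist_le_iff)
    define m where "m = length q - 1"
    have len: "length q = Suc m" using q(1) by (cases q) (auto simp: m_def path_between_def)
    have "h z \<le> h y + m" using path_height[OF lip q(1) len] by blast
    moreover have "h y \<le> h x" "m \<le> n" using x(3) that(1) q(2) by (auto simp: m_def)
    ultimately have "m = n" "h z = h y + n" using hz by auto
    then have "(y, z) \<in> ascents G B E h ^^ n"
      using path_height[OF lip q(1) len] by blast
    then show ?thesis using iterated_ascents_left_unique[OF fin down] z(2) by blast
  qed
  have "graph_dist G B E x z \<le> graph_dist G B E y z" if "y \<in> S" for y
    using far[OF that] near by (metis linear order.trans)
  moreover have "y = x" if "y \<in> nearest_points G B E S z" for y
  proof -
    have "y \<in> S" "graph_dist G B E y z \<le> graph_dist G B E x z"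
      using that x(1) by (auto simp: nearest_points_def)
    then show ?thesis using far near order.trans by metis
  qed
  ultimately have "nearest_points G B E S z = {x}"
    using x(1) by (auto simp: nearest_points_def)
  then show ?thesis using x(1) z(1) by (auto simp: extreme_point_def)
qed

lemma N_plus_uminus: "N_plus G B E (\<lambda>v. - h v) x = N_minus G B E h x"
  by (auto simp: N_plus_def N_minus_def)

lemma N_minus_uminus: "N_minus G B E (\<lambda>v. - h v) x = N_plus G B E h x"
  by (auto simp: N_plus_def N_minus_def)

theorem proposition1p8:
  fixes G B :: "'a set" and E :: "'a set set"
  assumes "finite_graph_with_boundary G B E"
    and "\<exists>h :: 'a \<Rightarrow> real.
           (\<forall>x\<in>G \<union> B. \<forall>y\<in>G \<union> B. adj E x y \<longrightarrow> \<bar>h x - h y\<bar> \<le> 1) \<and>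
           (\<forall>x\<in>G. card (N_plus G B E h x) = 1 \<and> card (N_minus G B E h x) = 1) \<and>
           (\<forall>z\<in>B. card (N_plus G B E h z) \<le> 1 \<and> card (N_minus G B E h z) \<le> 1)"
  shows "two_points_condition G B E"
  unfolding two_points_condition_def
proof (intro allI impI)
  fix S assume S: "S \<subseteq> G \<and> 2 \<le> card S"
  have fin: "finite (G \<union> B)"
    using assms(1) by (simp add: finite_graph_with_boundary_def)
  obtain h :: "'a \<Rightarrow> real" where
    lip: "\<forall>x\<in>G \<union> B. \<forall>y\<in>G \<union> B. adj E x y \<longrightarrow> \<bar>h x - h y\<bar> \<le> 1" and
    int: "\<forall>x\<in>G. card (N_plus G B E h x) = 1 \<and> card (N_minus G B E h x) = 1" and
    bdy: "\<forall>z\<in>B. card (N_plus G B E h z) \<le> 1 \<and> card (N_minus G B E h z) \<le> 1"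
    using assms(2) by blast
  have card_le: "\<forall>z\<in>G \<union> B. card (N_plus G B E h z) \<le> 1 \<and> card (N_minus G B E h z) \<le> 1"
    using int bdy by auto
  have nonempty: "\<forall>x\<in>G. N_plus G B E h x \<noteq> {} \<and> N_minus G B E h x \<noteq> {}"
    using int by (metis card.empty zero_neq_one)
  have highest: "extreme_point G B E S x" if "x \<in> S" "\<forall>y\<in>S. h y \<le> h x" for x
    by (rule highest_point_extreme[OF fin lip]) (use card_le nonempty S that in auto)
  have lowest: "extreme_point G B E S x" if "x \<in> S" "\<forall>y\<in>S. h x \<le> h y" for x
  proof (rule highest_point_extreme[OF fin])
    show "\<forall>x\<in>G \<union> B. \<forall>y\<in>G \<union> B. adj E x y \<longrightarrow> \<bar>- h x - - h y\<bar> \<le> 1"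
      using lip by (simp add: abs_minus_commute)
  qed (use card_le nonempty S that in \<open>auto simp: N_plus_uminus N_minus_uminus\<close>)
  have finS: "finite S" and "S \<noteq> {}" using S fin finite_subset by auto
  obtain a where a: "a \<in> S" "\<forall>y\<in>S. h y \<le> h a"
  proof -
    have "Max (h ` S) \<in> h ` S" using finS \<open>S \<noteq> {}\<close> by simp
    then obtain c where "c \<in> S" "h c = Max (h ` S)" by auto
    then show ?thesis using that[of c] finS by auto
  qed
  obtain b where b: "b \<in> S" "\<forall>y\<in>S. h b \<le> h y"
  proof -
    have "Min (h ` S) \<in> h ` S" using finS \<open>S \<noteq> {}\<close> by simp
    then obtain c where "c \<in> S" "h c = Min (h ` S)" by auto
    then show ?thesis using that[of c] finS by auto
  qed
  have "\<exists>c. c \<noteq> a \<and> extreme_point G B E S c"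
  proof (cases "a = b")
    case True
    \<comment> \<open>A point both highest and lowest: the height is constant on \<open>S\<close>.\<close>
    obtain c where "c \<in> S" "c \<noteq> a"
      using S a(1) finS by (metis card_le_Suc0_iff_eq not_less_eq_eq numeral_2_eq_2)
    moreover have "\<forall>y\<in>S. h y \<le> h c" using a b True \<open>c \<in> S\<close> by force
    ultimately show ?thesis using highest by blast
  next
    case False
    then show ?thesis using lowest[OF b] by auto
  qed
  then obtain c where "c \<noteq> a" "extreme_point G B E S c" by blast
  then have "{a, c} \<subseteq> {x. extreme_point G B E S x}" "card {a, c} = 2"
    using highest a by auto
  moreover have "finite {x. extreme_point G B E S x}"
    by (rule finite_subset[OF _ finS]) (auto simp: extreme_point_def)
  ultimately show "2 \<le> card {x. extreme_point G B E S x}" by (metis card_mono)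
qed

end
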